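(* If $\mathbf{HA}$ is closed under Markov's rule $\mathsf{MR}$, then $\mathbf{EA}$ is closed under epistemic Markov's rule $\mathsf{EMR}$.
   Context: $\mathbf{HA}$ is Heyting arithmetic; $\mathbf{EA}$ is Shapiro's epistemic arithmetic, i.e. Peano arithmetic (induction for all formulas of the modal language) over classical first-order logic with equality plus the S4 modal operator $\Box$. The languages of $\mathbf{HA}$ and $\mathbf{EA}$ are assumed to contain a common function symbol (with its defining equations) for every primitive recursive function. $\neg A$ is $A\supset\bot$ and $\Diamond A$ is $\neg\Box\neg A$. Let $R(x,y)$ range over formulas $f(x,y)=0$ with $f$ a binary primitive recursive function symbol. $\mathsf{MR}$ (for $\mathbf{HA}$): if $\vdash_{\mathbf{HA}}\forall x\neg\neg\exists yR(x,y)$ then $\vdash_{\mathbf{HA}}\forall x\exists yR(x,y)$. $\mathsf{EMR}$ (for $\mathbf{EA}$): if $\vdash_{\mathbf{EA}}\Box\forall x\Diamond\exists yR(x,y)$ then $\vdash_{\mathbf{EA}}\Box\forall x\exists yR(x,y)$. *)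

theory Defs
  imports Main
begin

section \<open>Primitive recursive function symbols\<close>

text \<open>There is one symbol for every definition of a primitive recursive function. The number stored
  in \<open>Comp\<close> is the arity of the composite, which would otherwise be undetermined when the list of
  inner functions is empty.\<close>

datatype pr =
    Zero
  | Succ
  | Proj nat nat
  | Comp nat pr "pr list"
  | Rec pr pr

inductive pr_sym :: "nat \<Rightarrow> pr \<Rightarrow> bool" where
  Zero: "pr_sym 0 Zero"
| Succ: "pr_sym 1 Succ"
| Proj: "i < n \<Longrightarrow> pr_sym n (Proj n i)"
| Comp: "pr_sym (length gs) f \<Longrightarrow> (\<And>g. g \<in> set gs \<Longrightarrow> pr_sym n g) \<Longrightarrow> pr_sym n (Comp n f gs)"
| Rec:  "pr_sym n f \<Longrightarrow> pr_sym (n + 2) g \<Longrightarrow> pr_sym (n + 1) (Rec f g)"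

section \<open>Terms and formulas\<close>

text \<open>Variables are de Bruijn indices: inside \<open>All\<close> and \<open>Ex\<close>, the bound variable is \<open>Var 0\<close>
  and the other variables are shifted by one. The raw datatypes do not enforce arities; this is done
  by \<open>wf_tm\<close> and \<open>wf_fm\<close>.\<close>

datatype tm = Var nat | Fn pr "tm list"

datatype fm =
    Eq tm tm
  | Bot
  | And fm fm
  | Or fm fm
  | Imp fm fm  (infixr "\<supset>" 55)
  | All fm
  | Ex fm
  | Box fm

abbreviation Neg :: "fm \<Rightarrow> fm" where "Neg A \<equiv> A \<supset> Bot"
abbreviation Dia :: "fm \<Rightarrow> fm" where "Dia A \<equiv> Neg (Box (Neg A))"

abbreviation zero :: tm where "zero \<equiv> Fn Zero []"
abbreviation suc :: "tm \<Rightarrow> tm" where "suc t \<equiv> Fn Succ [t]"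

fun wf_tm :: "tm \<Rightarrow> bool" where
  "wf_tm (Var n) \<longleftrightarrow> True"
| "wf_tm (Fn f ts) \<longleftrightarrow> pr_sym (length ts) f \<and> (\<forall>t \<in> set ts. wf_tm t)"

primrec wf_fm :: "fm \<Rightarrow> bool" where
  "wf_fm (Eq s t) \<longleftrightarrow> wf_tm s \<and> wf_tm t"
| "wf_fm Bot \<longleftrightarrow> True"
| "wf_fm (And A B) \<longleftrightarrow> wf_fm A \<and> wf_fm B"
| "wf_fm (Or A B) \<longleftrightarrow> wf_fm A \<and> wf_fm B"
| "wf_fm (A \<supset> B) \<longleftrightarrow> wf_fm A \<and> wf_fm B"
| "wf_fm (All A) \<longleftrightarrow> wf_fm A"
| "wf_fm (Ex A) \<longleftrightarrow> wf_fm A"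
| "wf_fm (Box A) \<longleftrightarrow> wf_fm A"

primrec box_free :: "fm \<Rightarrow> bool" where
  "box_free (Eq s t) \<longleftrightarrow> True"
| "box_free Bot \<longleftrightarrow> True"
| "box_free (And A B) \<longleftrightarrow> box_free A \<and> box_free B"
| "box_free (Or A B) \<longleftrightarrow> box_free A \<and> box_free B"
| "box_free (A \<supset> B) \<longleftrightarrow> box_free A \<and> box_free B"
| "box_free (All A) \<longleftrightarrow> box_free A"
| "box_free (Ex A) \<longleftrightarrow> box_free A"
| "box_free (Box A) \<longleftrightarrow> False"

definition lang_HA :: "fm set" where "lang_HA = {A. wf_fm A \<and> box_free A}"
definition lang_EA :: "fm set" where "lang_EA = {A. wf_fm A}"

text \<open>Simultaneous capture-avoiding substitution.\<close>

primrec subst_tm :: "(nat \<Rightarrow> tm) \<Rightarrow> tm \<Rightarrow> tm" where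
  "subst_tm \<sigma> (Var n) = \<sigma> n"
| "subst_tm \<sigma> (Fn f ts) = Fn f (map (subst_tm \<sigma>) ts)"

definition up :: "(nat \<Rightarrow> tm) \<Rightarrow> nat \<Rightarrow> tm" where
  "up \<sigma> = case_nat (Var 0) (\<lambda>n. subst_tm (\<lambda>m. Var (Suc m)) (\<sigma> n))"

primrec subst_fm :: "(nat \<Rightarrow> tm) \<Rightarrow> fm \<Rightarrow> fm" where
  "subst_fm \<sigma> (Eq s t) = Eq (subst_tm \<sigma> s) (subst_tm \<sigma> t)"
| "subst_fm \<sigma> Bot = Bot"
| "subst_fm \<sigma> (And A B) = And (subst_fm \<sigma> A) (subst_fm \<sigma> B)"
| "subst_fm \<sigma> (Or A B) = Or (subst_fm \<sigma> A) (subst_fm \<sigma> B)"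
| "subst_fm \<sigma> (A \<supset> B) = subst_fm \<sigma> A \<supset> subst_fm \<sigma> B"
| "subst_fm \<sigma> (All A) = All (subst_fm (up \<sigma>) A)"
| "subst_fm \<sigma> (Ex A) = Ex (subst_fm (up \<sigma>) A)"
| "subst_fm \<sigma> (Box A) = Box (subst_fm \<sigma> A)"

text \<open>\<open>inst t A\<close> removes one quantifier level, replacing \<open>Var 0\<close> by \<open>t\<close>; \<open>lift A\<close> moves \<open>A\<close> under
  a quantifier that does not bind anything in it; \<open>step A\<close> is \<open>A(x + 1)\<close>, where \<open>x\<close> is \<open>Var 0\<close>,
  the level being unchanged.\<close>

definition inst :: "tm \<Rightarrow> fm \<Rightarrow> fm" where
  "inst t = subst_fm (case_nat t Var)"

definition lift :: "fm \<Rightarrow> fm" where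
  "lift = subst_fm (\<lambda>n. Var (Suc n))"

definition step :: "fm \<Rightarrow> fm" where
  "step = subst_fm (case_nat (suc (Var 0)) (\<lambda>n. Var (Suc n)))"

section \<open>Axioms\<close>

text \<open>All axioms are stated for raw formulas; HA and EA each use the instances that lie in their own
  language.\<close>

text \<open>Intuitionistic first-order logic with equality.\<close>

inductive logic_ax :: "fm \<Rightarrow> bool" where
  "logic_ax (A \<supset> B \<supset> A)"
| "logic_ax ((A \<supset> B \<supset> C) \<supset> (A \<supset> B) \<supset> A \<supset> C)"
| "logic_ax (And A B \<supset> A)"
| "logic_ax (And A B \<supset> B)"
| "logic_ax (A \<supset> B \<supset> And A B)"
| "logic_ax (A \<supset> Or A B)"
| "logic_ax (B \<supset> Or A B)"
| "logic_ax ((A \<supset> C) \<supset> (B \<supset> C) \<supset> Or A B \<supset> C)"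
| "logic_ax (Bot \<supset> A)"
| "logic_ax (All A \<supset> inst t A)"
| "logic_ax (inst t A \<supset> Ex A)"
| "logic_ax (All (lift B \<supset> A) \<supset> B \<supset> All A)"
| "logic_ax (All (A \<supset> lift B) \<supset> Ex A \<supset> B)"
| "logic_ax (Eq t t)"
| "logic_ax (Eq s t \<supset> inst s A \<supset> inst t A)"

inductive arith_ax :: "fm \<Rightarrow> bool" where
  "arith_ax (Neg (Eq (suc t) zero))"
| "arith_ax (Eq (suc s) (suc t) \<supset> Eq s t)"
| "length ts = n \<Longrightarrow> i < n \<Longrightarrow> arith_ax (Eq (Fn (Proj n i) ts) (ts ! i))"
| "length ts = n \<Longrightarrow> arith_ax (Eq (Fn (Comp n f gs) ts) (Fn f (map (\<lambda>g. Fn g ts) gs)))"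
| "arith_ax (Eq (Fn (Rec f g) (zero # ts)) (Fn f ts))"
| "arith_ax (Eq (Fn (Rec f g) (suc t # ts)) (Fn g (t # Fn (Rec f g) (t # ts) # ts)))"
| "arith_ax (inst zero A \<supset> All (A \<supset> step A) \<supset> All A)"

inductive S4_ax :: "fm \<Rightarrow> bool" where
  "S4_ax (Box (A \<supset> B) \<supset> Box A \<supset> Box B)"
| "S4_ax (Box A \<supset> A)"
| "S4_ax (Box A \<supset> Box (Box A))"

section \<open>The theories HA and EA\<close>

inductive HA :: "fm \<Rightarrow> bool" where
  Logic: "logic_ax A \<Longrightarrow> A \<in> lang_HA \<Longrightarrow> HA A"
| Arith: "arith_ax A \<Longrightarrow> A \<in> lang_HA \<Longrightarrow> HA A"
| MP:    "HA (A \<supset> B) \<Longrightarrow> HA A \<Longrightarrow> HA B"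
| Gen:   "HA A \<Longrightarrow> HA (All A)"

inductive EA :: "fm \<Rightarrow> bool" where
  Logic: "logic_ax A \<Longrightarrow> A \<in> lang_EA \<Longrightarrow> EA A"
| LEM:   "A \<in> lang_EA \<Longrightarrow> EA (Or A (Neg A))"
| Arith: "arith_ax A \<Longrightarrow> A \<in> lang_EA \<Longrightarrow> EA A"
| S4:    "S4_ax A \<Longrightarrow> A \<in> lang_EA \<Longrightarrow> EA A"
| MP:    "EA (A \<supset> B) \<Longrightarrow> EA A \<Longrightarrow> EA B"
| Gen:   "EA A \<Longrightarrow> EA (All A)"
| Nec:   "EA A \<Longrightarrow> EA (Box A)"

section \<open>Markov's rule and epistemic Markov's rule\<close>

text \<open>\<open>R f\<close> is \<open>f(x,y) = 0\<close> as it occurs under the prefix \<open>\<forall>x\<exists>y\<close>: \<open>x\<close> is \<open>Var 1\<close>, \<open>y\<close> is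
  \<open>Var 0\<close>.\<close>

definition R :: "pr \<Rightarrow> fm" where
  "R f = Eq (Fn f [Var 1, Var 0]) zero"

definition closed_under_MR :: "(fm \<Rightarrow> bool) \<Rightarrow> bool" where
  "closed_under_MR T \<longleftrightarrow>
     (\<forall>f. pr_sym 2 f \<longrightarrow> T (All (Neg (Neg (Ex (R f))))) \<longrightarrow> T (All (Ex (R f))))"

definition closed_under_EMR :: "(fm \<Rightarrow> bool) \<Rightarrow> bool" where
  "closed_under_EMR T \<longleftrightarrow>
     (\<forall>f. pr_sym 2 f \<longrightarrow> T (Box (All (Dia (Ex (R f))))) \<longrightarrow> T (Box (All (Ex (R f)))))"

end

(* Composing the erasure of Box with the Goedel-Gentzen negative translation interprets EA in HA.
   The premise of EMR becomes, up to HA-provable equivalence, the premise of MR. Conversely every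
   theorem of HA is literally a theorem of EA, so the conclusion of MR carries over to EA, where
   necessitation restores the Box. *)
theory Submission
  imports Defs
begin

no_notation supset  (\<open>(\<open>notation=\<open>infix \<supset>\<close>\<close>_/ \<supset> _)\<close> [51, 51] 50)

section \<open>Substitution\<close>

lemma subst_tm_Var [simp]: "subst_tm Var t = t"
  by (induction t) (auto intro: map_idI)

lemma up_Var [simp]: "up Var = Var"
  by (auto simp: up_def split: nat.split)

lemma subst_fm_Var [simp]: "subst_fm Var A = A"
  by (induction A) auto

text \<open>The function \<open>case_nat 0 (\<lambda>n. Suc (\<rho> n))\<close> is
  \<open>\<rho>\<close> lifted over a binder; absorbing it into \<open>up\<close> carries the
  induction of \<open>subst_fm_rename\<close> past quantifiers.\<close>

lemma up_comp_rename: "up \<sigma> \<circ> case_nat 0 (\<lambda>n. Suc (\<rho> n)) = up (\<sigma> \<circ> \<rho>)"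
  by (auto simp: up_def split: nat.split)

lemma up_rename: "up (\<lambda>n. Var (\<rho> n)) = (\<lambda>n. Var (case_nat 0 (\<lambda>n. Suc (\<rho> n)) n))"
  by (auto simp: up_def split: nat.split)

lemma subst_tm_rename: "subst_tm \<sigma> (subst_tm (\<lambda>n. Var (\<rho> n)) t) = subst_tm (\<sigma> \<circ> \<rho>) t"
  by (induction t) auto

lemma subst_fm_rename: "subst_fm \<sigma> (subst_fm (\<lambda>n. Var (\<rho> n)) A) = subst_fm (\<sigma> \<circ> \<rho>) A"
  by (induction A arbitrary: \<sigma> \<rho>) (auto simp: subst_tm_rename up_rename up_comp_rename)

text \<open>The argument of \<open>inst\<close> is the body of \<open>lift (All A)\<close>: index 0
  stays put and index n + 1 goes to n + 2, which instantiation lowers back to n + 1.\<close>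

lemma inst_Var_0_subst_up_shift: "inst (Var 0) (subst_fm (up (\<lambda>n. Var (Suc n))) A) = A"
proof -
  have "case_nat (Var 0) Var \<circ> case_nat 0 (\<lambda>n. Suc (Suc n)) = Var"
    by (auto split: nat.split)
  then show ?thesis
    by (simp add: inst_def up_rename subst_fm_rename)
qed

lemma wf_subst_tm: "wf_tm t \<Longrightarrow> (\<And>n. wf_tm (\<sigma> n)) \<Longrightarrow> wf_tm (subst_tm \<sigma> t)"
  by (induction t) auto

lemma wf_up: "(\<And>n. wf_tm (\<sigma> n)) \<Longrightarrow> wf_tm (up \<sigma> n)"
  by (auto simp: up_def wf_subst_tm split: nat.split)

lemma wf_subst_fm: "wf_fm A \<Longrightarrow> (\<And>n. wf_tm (\<sigma> n)) \<Longrightarrow> wf_fm (subst_fm \<sigma> A)"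
  by (induction A arbitrary: \<sigma>) (auto simp: wf_subst_tm wf_up)

lemma box_free_subst [simp]: "box_free (subst_fm \<sigma> A) = box_free A"
  by (induction A arbitrary: \<sigma>) auto

section \<open>Derivations in HA\<close>

lemma lang_HA_simps [simp]:
  "Bot \<in> lang_HA"
  "And A B \<in> lang_HA \<longleftrightarrow> A \<in> lang_HA \<and> B \<in> lang_HA"
  "Or A B \<in> lang_HA \<longleftrightarrow> A \<in> lang_HA \<and> B \<in> lang_HA"
  "(A \<supset> B) \<in> lang_HA \<longleftrightarrow> A \<in> lang_HA \<and> B \<in> lang_HA"
  "All A \<in> lang_HA \<longleftrightarrow> A \<in> lang_HA"
  "Ex A \<in> lang_HA \<longleftrightarrow> A \<in> lang_HA"
  by (auto simp: lang_HA_def)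

lemma subst_fm_in_lang_HA: "A \<in> lang_HA \<Longrightarrow> (\<And>n. wf_tm (\<sigma> n)) \<Longrightarrow> subst_fm \<sigma> A \<in> lang_HA"
  by (auto simp: lang_HA_def wf_subst_fm)

lemma lift_in_lang_HA [simp]: "A \<in> lang_HA \<Longrightarrow> lift A \<in> lang_HA"
  by (simp add: lift_def subst_fm_in_lang_HA)

lemma HA_in_lang: "HA A \<Longrightarrow> A \<in> lang_HA"
  by (induction rule: HA.induct) auto

text \<open>Generalization is confined to \<open>Thm\<close>, so hypotheses may contain free variables and the
  deduction theorem holds without side conditions on them.\<close>

inductive derives :: "fm set \<Rightarrow> fm \<Rightarrow> bool"  (infix "\<tturnstile>" 50) for \<Gamma> where
  Thm: "HA A \<Longrightarrow> \<Gamma> \<tturnstile> A"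
| Hyp: "A \<in> \<Gamma> \<Longrightarrow> A \<in> lang_HA \<Longrightarrow> \<Gamma> \<tturnstile> A"
| MP: "\<Gamma> \<tturnstile> A \<supset> B \<Longrightarrow> \<Gamma> \<tturnstile> A \<Longrightarrow> \<Gamma> \<tturnstile> B"

section \<open>Derivability from hypotheses and the deduction theorem\<close>

lemma derives_in_lang: "\<Gamma> \<tturnstile> A \<Longrightarrow> A \<in> lang_HA"
  by (induction rule: derives.induct) (auto dest: HA_in_lang)

lemma HA_if_derives_empty: "{} \<tturnstile> A \<Longrightarrow> HA A"
  by (induction rule: derives.induct) (auto intro: HA.MP)

lemma derives_logic: "logic_ax A \<Longrightarrow> A \<in> lang_HA \<Longrightarrow> \<Gamma> \<tturnstile> A"
  by (intro derives.Thm HA.Logic)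

lemma derives_K: "\<Gamma> \<tturnstile> B \<Longrightarrow> A \<in> lang_HA \<Longrightarrow> \<Gamma> \<tturnstile> A \<supset> B"
  by (rule derives.MP[OF derives_logic[OF logic_ax.intros(1)]]) (auto dest: derives_in_lang)

lemma derives_S:
  assumes "\<Gamma> \<tturnstile> A \<supset> B \<supset> C" "\<Gamma> \<tturnstile> A \<supset> B"
  shows "\<Gamma> \<tturnstile> A \<supset> C"
proof -
  have "\<Gamma> \<tturnstile> (A \<supset> B \<supset> C) \<supset> (A \<supset> B) \<supset> A \<supset> C"
    using derives_in_lang[OF assms(1)] by (intro derives_logic logic_ax.intros(2)) auto
  with assms show ?thesis
    by (blast intro: derives.MP)
qed

lemma derives_refl: "A \<in> lang_HA \<Longrightarrow> \<Gamma> \<tturnstile> A \<supset> A"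
  by (rule derives_S[where B = "A \<supset> A"]) (auto intro!: derives_logic logic_ax.intros(1))

lemma deduction:
  assumes "insert A \<Gamma> \<tturnstile> B" "A \<in> lang_HA"
  shows "\<Gamma> \<tturnstile> A \<supset> B"
  using assms
proof (induction rule: derives.induct)
  case (Hyp B)
  then show ?case
    by (auto intro: derives_K derives.Hyp derives_refl)
qed (auto intro: derives_K derives.Thm derives_S)

section \<open>Refutation and conjunction rules in a context\<close>

lemma derives_Bot_Hyp: "\<Gamma> \<tturnstile> A \<Longrightarrow> Neg A \<in> \<Gamma> \<Longrightarrow> \<Gamma> \<tturnstile> Bot"
  by (rule derives.MP[OF derives.Hyp]) (auto dest: derives_in_lang)

text \<open>The recurring move of the arguments below: the context already contains
  \<open>Neg B\<close>, so \<open>A\<close> is refuted by deriving \<open>B\<close> from it.\<close>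

lemma derives_NegI_Hyp:
  assumes "insert A \<Gamma> \<tturnstile> B" "Neg B \<in> \<Gamma>" "A \<in> lang_HA"
  shows "\<Gamma> \<tturnstile> Neg A"
  using assms by (intro deduction derives_Bot_Hyp[where A = B]) auto

lemma derives_MP_Hyp: "\<Gamma> \<tturnstile> A \<supset> B \<Longrightarrow> A \<in> \<Gamma> \<Longrightarrow> \<Gamma> \<tturnstile> B"
  by (rule derives.MP[OF _ derives.Hyp]) (auto dest: derives_in_lang)

lemma derives_conjI: "\<Gamma> \<tturnstile> A \<Longrightarrow> \<Gamma> \<tturnstile> B \<Longrightarrow> \<Gamma> \<tturnstile> And A B"
  by (rule derives.MP[OF derives.MP[OF derives_logic[OF logic_ax.intros(5)]]])
    (auto dest: derives_in_lang)

lemma derives_conjD1: "\<Gamma> \<tturnstile> And A B \<Longrightarrow> \<Gamma> \<tturnstile> A"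
  by (rule derives.MP[OF derives_logic[OF logic_ax.intros(3)]]) (auto dest: derives_in_lang)

lemma derives_conjD2: "\<Gamma> \<tturnstile> And A B \<Longrightarrow> \<Gamma> \<tturnstile> B"
  by (rule derives.MP[OF derives_logic[OF logic_ax.intros(4)]]) (auto dest: derives_in_lang)

section \<open>Quantifier rules across a binder\<close>

lemma HA_lift_All: "A \<in> lang_HA \<Longrightarrow> HA (lift (All A) \<supset> A)"
proof -
  assume "A \<in> lang_HA"
  \<comment> \<open>Instantiating the quantifier of \<open>lift (All A)\<close> with
    \<open>Var 0\<close>, the variable freed by the shift, gives back \<open>A\<close>.\<close>
  then show ?thesis
    using HA.Logic[OF logic_ax.intros(10)[of "subst_fm (up (\<lambda>n. Var (Suc n))) A" "Var 0"]]
    by (simp add: inst_Var_0_subst_up_shift lift_def subst_fm_in_lang_HA wf_up)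
qed

lemma HA_lift_Ex: "A \<in> lang_HA \<Longrightarrow> HA (A \<supset> lift (Ex A))"
proof -
  assume "A \<in> lang_HA"
  then show ?thesis
    using HA.Logic[OF logic_ax.intros(11)[of "Var 0" "subst_fm (up (\<lambda>n. Var (Suc n))) A"]]
    by (simp add: inst_Var_0_subst_up_shift lift_def subst_fm_in_lang_HA wf_up)
qed

lemma lift_Imp [simp]: "lift (A \<supset> B) = lift A \<supset> lift B"
  and lift_Bot [simp]: "lift Bot = Bot"
  and lift_And [simp]: "lift (And A B) = And (lift A) (lift B)"
  by (simp_all add: lift_def)

text \<open>\<open>lift B\<close> cannot mention \<open>Var 0\<close>, which is the eigenvariable
  condition. Since only theorems are generalized, hypotheses are first gathered into the single
  formula \<open>B\<close>.\<close>

lemma HA_AllI: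
  assumes "HA (lift B \<supset> A)" "B \<in> lang_HA"
  shows "HA (B \<supset> All A)"
proof -
  have "HA (All (lift B \<supset> A) \<supset> B \<supset> All A)"
    using assms HA_in_lang[OF assms(1)] by (intro HA.Logic logic_ax.intros(12)) auto
  then show ?thesis
    using assms by (blast intro: HA.MP HA.Gen)
qed

section \<open>Double negation and stability\<close>

lemma derives_Neg_NegI:
  assumes "\<Gamma> \<tturnstile> A"
  shows "\<Gamma> \<tturnstile> Neg (Neg A)"
proof -
  have "A \<in> lang_HA"
    using assms by (rule derives_in_lang)
  \<comment> \<open>The first formula is also \<open>Neg A \<supset> A \<supset> Bot\<close>, so
    \<open>derives_S\<close> yields \<open>Neg A \<supset> Bot\<close>.\<close>
  then have "\<Gamma> \<tturnstile> Neg A \<supset> Neg A" "\<Gamma> \<tturnstile> Neg A \<supset> A"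
    using assms by (simp_all add: derives_refl derives_K)
  then show ?thesis
    by (rule derives_S)
qed

lemma HA_stable_Neg:
  assumes "A \<in> lang_HA"
  shows "HA (Neg (Neg (Neg A)) \<supset> Neg A)"
proof -
  let ?G = "{A, Neg (Neg (Neg A))}"
  have "?G \<tturnstile> Neg (Neg A)"
    using assms by (intro derives_Neg_NegI derives.Hyp) auto
  then have "?G \<tturnstile> Bot"
    using assms by (intro derives_Bot_Hyp[where A = "Neg (Neg A)"]) auto
  then show ?thesis
    using assms by (intro HA_if_derives_empty deduction) auto
qed

lemma HA_imp_trans:
  assumes "HA (A \<supset> B)" "HA (B \<supset> C)"
  shows "HA (A \<supset> C)"
proof -
  have "A \<in> lang_HA"
    using HA_in_lang[OF assms(1)] by simp
  then show ?thesis
    using derives_S[OF derives_K[OF derives.Thm[OF assms(2)]] derives.Thm[OF assms(1)]]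
    by (blast intro: HA_if_derives_empty)
qed

lemma HA_double_negI: "HA A \<Longrightarrow> HA (Neg (Neg A))"
  by (rule HA_if_derives_empty[OF derives_Neg_NegI[OF derives.Thm]])

text \<open>Reductio is constructively sound for stable formulas, and every translated formula will
  be stable.\<close>

lemma derives_by_contradiction:
  assumes "HA (Neg (Neg B) \<supset> B)" "insert (Neg B) \<Gamma> \<tturnstile> Bot"
  shows "\<Gamma> \<tturnstile> B"
  using assms HA_in_lang[OF assms(1)]
  by (intro derives.MP[OF derives.Thm[OF assms(1)]] deduction) auto

section \<open>The negative translation with Box erased\<close>

text \<open>Each clause keeps formulas stable: \<open>Or\<close> and \<open>Ex\<close> become
  negations by de Morgan duality, atoms get a double negation, and \<open>Bot\<close> is stable
  already.\<close>

primrec neg_trans :: "fm \<Rightarrow> fm" where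
  "neg_trans (Eq s t) = Neg (Neg (Eq s t))"
| "neg_trans Bot = Bot"
| "neg_trans (And A B) = And (neg_trans A) (neg_trans B)"
| "neg_trans (Or A B) = Neg (And (Neg (neg_trans A)) (Neg (neg_trans B)))"
| "neg_trans (A \<supset> B) = neg_trans A \<supset> neg_trans B"
| "neg_trans (All A) = All (neg_trans A)"
| "neg_trans (Ex A) = Neg (All (Neg (neg_trans A)))"
| "neg_trans (Box A) = neg_trans A"

text \<open>This turns translated instances of universal instantiation and of induction into
  instances of the same schemas.\<close>

lemma neg_trans_subst: "neg_trans (subst_fm \<sigma> A) = subst_fm \<sigma> (neg_trans A)"
  by (induction A arbitrary: \<sigma>) auto

lemma neg_trans_inst [simp]: "neg_trans (inst t A) = inst t (neg_trans A)"
  and neg_trans_lift [simp]: "neg_trans (lift A) = lift (neg_trans A)"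
  and neg_trans_step [simp]: "neg_trans (step A) = step (neg_trans A)"
  by (simp_all add: inst_def lift_def step_def neg_trans_subst)

lemma neg_trans_in_lang_HA: "A \<in> lang_EA \<Longrightarrow> neg_trans A \<in> lang_HA"
  unfolding lang_EA_def by (induction A) (auto simp: lang_HA_def)

text \<open>Equations, disjunctions and existentials translate to negations, which are stable by
  \<open>HA_stable_Neg\<close>; conjunction, implication and universal quantification inherit
  stability, and \<open>Box\<close> vanishes.\<close>

lemma HA_neg_trans_stable:
  "neg_trans A \<in> lang_HA \<Longrightarrow> HA (Neg (Neg (neg_trans A)) \<supset> neg_trans A)"
proof (induction A)
  case Bot
  have "{Neg (Neg Bot)} \<tturnstile> Bot"
    by (rule derives_Bot_Hyp[where A = "Neg Bot"]) (auto intro: derives_refl)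
  from deduction[OF this] show ?case
    by (auto intro: HA_if_derives_empty)
next
  case (And A B)
  let ?A = "neg_trans A" and ?B = "neg_trans B"
  have L: "?A \<in> lang_HA" "?B \<in> lang_HA" using And.prems by auto
  let ?G = "{Neg (Neg (And ?A ?B))}"
  \<comment> \<open>Here \<open>C\<close> is one of the conjuncts: refuting it would refute the
    conjunction, whose double negation is assumed.\<close>
  have nn: "?G \<tturnstile> Neg (Neg C)"
    if "insert (And ?A ?B) (insert (Neg C) ?G) \<tturnstile> C" "C \<in> lang_HA" for C
  proof -
    have "insert (Neg C) ?G \<tturnstile> Neg (And ?A ?B)"
      using that L by (intro derives_NegI_Hyp[where B = C]) auto
    then have "insert (Neg C) ?G \<tturnstile> Bot"
      by (intro derives_Bot_Hyp[where A = "Neg (And ?A ?B)"]) auto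
    then show ?thesis
      using that by (intro deduction) auto
  qed
  have "insert (And ?A ?B) (insert (Neg C) ?G) \<tturnstile> And ?A ?B" for C
    using L by (intro derives.Hyp) auto
  then have "?G \<tturnstile> Neg (Neg ?A)" "?G \<tturnstile> Neg (Neg ?B)"
    using L by (blast intro: nn derives_conjD1 derives_conjD2)+
  then have "?G \<tturnstile> ?A" "?G \<tturnstile> ?B"
    using L And.IH by (auto intro: derives.MP[OF derives.Thm])
  then show ?case
    using L by (auto intro!: HA_if_derives_empty deduction derives_conjI)
next
  case (Imp A B)
  let ?A = "neg_trans A" and ?B = "neg_trans B"
  have L: "?A \<in> lang_HA" "?B \<in> lang_HA" using Imp.prems by auto
  \<comment> \<open>Under \<open>?A\<close> and \<open>Neg ?B\<close> the implication is refutable,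
    so stability of the consequent \<open>?B\<close> settles the case.\<close>
  let ?G = "{Neg ?B, ?A, Neg (Neg (?A \<supset> ?B))}"
  have "insert (?A \<supset> ?B) ?G \<tturnstile> ?B"
    using L by (intro derives_MP_Hyp[of _ ?A ?B] derives.Hyp) auto
  then have "?G \<tturnstile> Neg (?A \<supset> ?B)"
    using L by (intro derives_NegI_Hyp[where B = "?B"]) auto
  then have "?G \<tturnstile> Bot"
    using L by (intro derives_Bot_Hyp[where A = "Neg (?A \<supset> ?B)"]) auto
  then have "{} \<tturnstile> Neg (Neg (?A \<supset> ?B)) \<supset> ?A \<supset> ?B"
    using L Imp.IH by (auto intro!: deduction intro: derives_by_contradiction)
  then show ?case
    by (auto intro: HA_if_derives_empty)
next
  case (All A)
  let ?A = "neg_trans A"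
  have L: "?A \<in> lang_HA" using All.prems by auto
  \<comment> \<open>The argument runs inside the binder: \<open>?A\<close> has \<open>Var 0\<close>
    as parameter, and the hypothesis is lifted so that \<open>HA_AllI\<close> can close the
    quantifier.\<close>
  let ?G = "{Neg ?A, Neg (Neg (lift (All ?A)))}"
  have L': "lift (All ?A) \<in> lang_HA" using L by simp
  have "insert (lift (All ?A)) ?G \<tturnstile> ?A"
    using L L' by (intro derives_MP_Hyp[OF derives.Thm[OF HA_lift_All]]) auto
  then have "?G \<tturnstile> Neg (lift (All ?A))"
    using L L' by (intro derives_NegI_Hyp[where B = "?A"]) auto
  then have "?G \<tturnstile> Bot"
    using L L' by (intro derives_Bot_Hyp[where A = "Neg (lift (All ?A))"]) auto
  then have "HA (Neg (Neg (lift (All ?A))) \<supset> ?A)"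
    using L L' All.IH
    by (auto intro!: HA_if_derives_empty deduction intro: derives_by_contradiction)
  then show ?case
    using L by (auto intro: HA_AllI)
qed (auto intro: HA_stable_Neg)

text \<open>Disjunction, existence and equality need an argument; the other axioms translate to
  instances of themselves. Both eliminations and the replacement of equals rest on stability of the
  conclusion.\<close>

lemma HA_neg_trans_logic_ax:
  assumes "logic_ax A" "neg_trans A \<in> lang_HA"
  shows "HA (neg_trans A)"
  using assms
proof (induction rule: logic_ax.induct)
  case (6 A B)
  let ?A = "neg_trans A" and ?B = "neg_trans B"
  let ?G = "{And (Neg ?A) (Neg ?B), ?A}"
  have "?G \<tturnstile> Neg ?A"
    using 6 by (intro derives_conjD1[of _ "Neg ?A" "Neg ?B"] derives.Hyp) auto
  then have "?G \<tturnstile> Bot"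
    using 6 by (auto intro: derives_MP_Hyp)
  then show ?case
    using 6 by (auto intro!: HA_if_derives_empty deduction)
next
  case (7 B A)
  let ?A = "neg_trans A" and ?B = "neg_trans B"
  let ?G = "{And (Neg ?A) (Neg ?B), ?B}"
  have "?G \<tturnstile> Neg ?B"
    using 7 by (intro derives_conjD2[of _ "Neg ?A" "Neg ?B"] derives.Hyp) auto
  then have "?G \<tturnstile> Bot"
    using 7 by (auto intro: derives_MP_Hyp)
  then show ?case
    using 7 by (auto intro!: HA_if_derives_empty deduction)
next
  case (8 A C B)
  let ?A = "neg_trans A" and ?B = "neg_trans B" and ?C = "neg_trans C"
  let ?D = "And (Neg ?A) (Neg ?B)"
  have L: "?A \<in> lang_HA" "?B \<in> lang_HA" "?C \<in> lang_HA" using 8 by auto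
  let ?G = "{Neg ?C, Neg ?D, ?B \<supset> ?C, ?A \<supset> ?C}"
  \<comment> \<open>A disjunct that implies \<open>?C\<close> is refutable once
    \<open>Neg ?C\<close> is assumed; the two refutations together give \<open>?D\<close>.\<close>
  have neg: "?G \<tturnstile> Neg X" if "X \<in> lang_HA" "X \<supset> ?C \<in> ?G" for X
  proof -
    have "insert X ?G \<tturnstile> ?C"
      using that L by (intro derives_MP_Hyp[of _ X ?C] derives.Hyp) auto
    then show ?thesis
      using that L by (intro derives_NegI_Hyp[where B = "?C"]) auto
  qed
  have "?G \<tturnstile> ?D"
    using L by (intro derives_conjI neg) auto
  then have "?G \<tturnstile> Bot"
    using L by (intro derives_Bot_Hyp[where A = "?D"]) auto
  then have "{Neg ?D, ?B \<supset> ?C, ?A \<supset> ?C} \<tturnstile> ?C"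
    using L by (intro derives_by_contradiction[OF HA_neg_trans_stable[of C]]) auto
  then show ?case
    using L by (auto intro!: HA_if_derives_empty deduction)
next
  case (11 t A)
  let ?A = "neg_trans A"
  have L: "inst t ?A \<in> lang_HA" "?A \<in> lang_HA" using 11 by auto
  let ?G = "{All (Neg ?A), inst t ?A}"
  have I: "inst t (Neg ?A) = Neg (inst t ?A)" by (simp add: inst_def)
  have "HA (All (Neg ?A) \<supset> inst t (Neg ?A))"
    using L by (intro HA.Logic logic_ax.intros(10)) (simp add: I)
  then have "?G \<tturnstile> Neg (inst t ?A)"
    using L by (intro derives_MP_Hyp[OF derives.Thm]) (auto simp: I)
  then have "?G \<tturnstile> Bot"
    using L by (auto intro: derives_MP_Hyp)
  then show ?case
    using L by (auto intro!: HA_if_derives_empty deduction)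
next
  case (13 A B)
  let ?A = "neg_trans A" and ?B = "neg_trans B"
  let ?H = "All (?A \<supset> lift ?B)"
  have L: "?A \<in> lang_HA" "lift ?B \<in> lang_HA" "?B \<in> lang_HA" using 13 by auto
  \<comment> \<open>The two hypotheses are packed into one formula so that \<open>HA_AllI\<close>
    can derive \<open>All (Neg ?A)\<close> from them.\<close>
  let ?K = "And ?H (Neg ?B)"
  have LK: "lift ?K \<in> lang_HA" "lift ?H \<in> lang_HA" using L by simp_all
  have K: "{?A, lift ?K} \<tturnstile> And (lift ?H) (Neg (lift ?B))"
    using LK L by (intro derives.Hyp) auto
  have "{?A, lift ?K} \<tturnstile> ?A \<supset> lift ?B"
    by (rule derives.MP[OF derives.Thm[OF HA_lift_All] derives_conjD1[OF K]]) (use L in auto)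
  then have "{?A, lift ?K} \<tturnstile> lift ?B"
    using L by (auto intro: derives_MP_Hyp)
  with derives_conjD2[OF K] have "{?A, lift ?K} \<tturnstile> Bot"
    by (rule derives.MP)
  then have "HA (lift ?K \<supset> Neg ?A)"
    using L LK by (intro HA_if_derives_empty deduction) auto
  then have K_imp: "HA (?K \<supset> All (Neg ?A))"
    using L by (intro HA_AllI) auto
  let ?G = "{Neg ?B, Neg (All (Neg ?A)), ?H}"
  have "?G \<tturnstile> All (Neg ?A)"
    using L by (intro derives.MP[OF derives.Thm[OF K_imp] derives_conjI] derives.Hyp) auto
  then have "?G \<tturnstile> Bot"
    using L by (intro derives_Bot_Hyp[where A = "All (Neg ?A)"]) auto
  then have "{Neg (All (Neg ?A)), ?H} \<tturnstile> ?B"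
    using L by (intro derives_by_contradiction[OF HA_neg_trans_stable[of B]]) auto
  then show ?case
    using L by (auto intro!: HA_if_derives_empty deduction)
next
  case (14 t)
  then show ?case
    by (auto intro!: HA_double_negI HA.Logic logic_ax.intros)
next
  case (15 s t A)
  let ?s = "neg_trans (inst s A)" and ?t = "neg_trans (inst t A)" and ?E = "Eq s t"
  have L: "?s \<in> lang_HA" "?t \<in> lang_HA" "?E \<in> lang_HA" using 15 by auto
  let ?G = "{Neg ?t, ?s, Neg (Neg ?E)}"
  \<comment> \<open>This is the replacement axiom for \<open>neg_trans A\<close>, with
    \<open>?E\<close> as antecedent. The translation supplies only \<open>Neg (Neg ?E)\<close>;
    stability of \<open>?t\<close> bridges the gap.\<close>
  have "HA (?E \<supset> ?s \<supset> ?t)"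
    using L by (auto intro!: HA.Logic logic_ax.intros)
  then have "insert ?E ?G \<tturnstile> ?t"
    using L by (intro derives_MP_Hyp[of _ ?s ?t] derives_MP_Hyp[of _ ?E "?s \<supset> ?t"] derives.Thm) auto
  then have "?G \<tturnstile> Neg ?E"
    using L by (intro derives_NegI_Hyp[where B = "?t"]) auto
  then have "?G \<tturnstile> Bot"
    using L by (intro derives_Bot_Hyp[where A = "Neg ?E"]) auto
  then have "{?s, Neg (Neg ?E)} \<tturnstile> ?t"
    using L by (intro derives_by_contradiction[OF HA_neg_trans_stable[of "inst t A"]]) auto
  then have "HA (Neg (Neg ?E) \<supset> ?s \<supset> ?t)"
    using L by (intro HA_if_derives_empty deduction) auto
  then show ?case
    by simp
qed (simp, rule HA.Logic, rule logic_ax.intros, simp)+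

text \<open>The defining equations and the first successor axiom translate to double negations of
  themselves, and induction to induction for \<open>neg_trans A\<close>. Injectivity of the
  successor is lifted through double negations by hand.\<close>

lemma HA_neg_trans_arith_ax:
  assumes "arith_ax A" "neg_trans A \<in> lang_HA"
  shows "HA (neg_trans A)"
  using assms
proof (induction rule: arith_ax.induct)
  case (1 t)
  then show ?case
    by (auto intro!: HA_double_negI HA.Arith arith_ax.intros)
next
  case (2 s t)
  let ?E = "Eq (suc s) (suc t)" and ?F = "Eq s t"
  have L: "?E \<in> lang_HA" "?F \<in> lang_HA" using 2 by auto
  let ?G = "{Neg ?F, Neg (Neg ?E)}"
  have "HA (?E \<supset> ?F)"
    using L by (auto intro!: HA.Arith arith_ax.intros)
  then have "insert ?E ?G \<tturnstile> ?F"
    using L by (intro derives_MP_Hyp[OF derives.Thm]) auto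
  then have "?G \<tturnstile> Neg ?E"
    using L by (intro derives_NegI_Hyp[where B = "?F"]) auto
  then have "?G \<tturnstile> Bot"
    using L by (intro derives_Bot_Hyp[where A = "Neg ?E"]) auto
  then show ?case
    using L by (auto intro!: HA_if_derives_empty deduction)
qed ((simp, (rule HA_double_negI)?, rule HA.Arith, rule arith_ax.intros, simp_all)[1])+

text \<open>With \<open>Box\<close> erased, each of the three axioms has the form
  \<open>X \<supset> X\<close>.\<close>

lemma HA_neg_trans_S4_ax:
  assumes "S4_ax A" "neg_trans A \<in> lang_HA"
  shows "HA (neg_trans A)"
  using assms by cases (auto intro!: HA_if_derives_empty derives_refl)

text \<open>Excluded middle translates to an instance of noncontradiction, for the formula
  \<open>Neg (neg_trans A)\<close>.\<close>

lemma HA_neg_trans_LEM: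
  assumes "neg_trans A \<in> lang_HA"
  shows "HA (neg_trans (Or A (Neg A)))"
proof -
  let ?A = "neg_trans A"
  let ?D = "And (Neg ?A) (Neg (Neg ?A))"
  have "{?D} \<tturnstile> ?D" using assms by (auto intro: derives.Hyp)
  then have "{?D} \<tturnstile> Bot"
    by (meson derives.MP derives_conjD1 derives_conjD2)
  then show ?thesis
    using assms by (auto intro!: HA_if_derives_empty deduction)
qed

text \<open>Necessitation is immediate because \<open>Box A\<close> and \<open>A\<close> have the
  same translation; the translation commutes with implication and \<open>All\<close>, which settles
  \<open>MP\<close> and \<open>Gen\<close>.\<close>

theorem HA_neg_trans_if_EA: "EA A \<Longrightarrow> HA (neg_trans A)"
proof (induction rule: EA.induct)
  case (MP A B)
  then show ?case
    by (metis HA.MP neg_trans.simps(5))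
qed (simp_all only: neg_trans.simps(6,8) HA.Gen HA_neg_trans_logic_ax HA_neg_trans_arith_ax
    HA_neg_trans_S4_ax HA_neg_trans_LEM neg_trans_in_lang_HA)

section \<open>Transfer of Markov's rule\<close>

lemma EA_if_HA: "HA A \<Longrightarrow> EA A"
  by (induction rule: HA.induct) (auto intro: EA.intros simp: lang_HA_def lang_EA_def)

lemma HA_All_mono:
  assumes "HA (A \<supset> B)" "HA (All A)"
  shows "HA (All B)"
proof -
  have L: "A \<in> lang_HA" using HA_in_lang[OF assms(2)] by simp
  then have "HA (lift (All A) \<supset> B)"
    by (rule HA_imp_trans[OF HA_lift_All assms(1)])
  with L have "HA (All A \<supset> All B)"
    by (intro HA_AllI) auto
  with assms(2) show ?thesis
    by (blast intro: HA.MP)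
qed

text \<open>For an equation \<open>A\<close>, the antecedent is the translation of
  \<open>Dia (Ex A)\<close> and the consequent is the matrix of the premise of Markov's
  rule.\<close>

lemma HA_double_neg_Ex:
  assumes "A \<in> lang_HA"
  shows "HA (Neg (Neg (Neg (All (Neg (Neg (Neg A)))))) \<supset> Neg (Neg (Ex A)))"
proof -
  let ?U = "All (Neg (Neg (Neg A)))"
  have L: "lift (Ex A) \<in> lang_HA" using assms by simp
  \<comment> \<open>Assuming \<open>Neg (Neg A)\<close> prepares the triple negation that forms the
    body of \<open>?U\<close>.\<close>
  let ?G = "{Neg (Neg A), Neg (lift (Ex A))}"
  have "insert A ?G \<tturnstile> lift (Ex A)"
    using assms by (intro derives_MP_Hyp[OF derives.Thm[OF HA_lift_Ex]]) auto
  then have "?G \<tturnstile> Neg A"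
    using assms L by (intro derives_NegI_Hyp[where B = "lift (Ex A)"]) auto
  then have "?G \<tturnstile> Bot"
    using assms by (intro derives_Bot_Hyp[where A = "Neg A"]) auto
  then have "HA (lift (Neg (Ex A)) \<supset> Neg (Neg (Neg A)))"
    using assms L by (auto intro!: HA_if_derives_empty deduction)
  then have U: "HA (Neg (Ex A) \<supset> ?U)"
    using assms by (intro HA_AllI) auto
  \<comment> \<open>\<open>Neg (Ex A)\<close> yields \<open>?U\<close>, hence
    \<open>Neg (Neg ?U)\<close>, against the triple negation of \<open>?U\<close>.\<close>
  let ?H = "{Neg (Ex A), Neg (Neg (Neg ?U))}"
  have "insert (Neg ?U) ?H \<tturnstile> Bot"
    using assms
    by (intro derives_Bot_Hyp[where A = ?U] derives_MP_Hyp[OF derives.Thm[OF U]]) auto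
  then have "?H \<tturnstile> Neg (Neg ?U)"
    using assms by (auto intro: deduction)
  then have "?H \<tturnstile> Bot"
    using assms by (intro derives_Bot_Hyp[where A = "Neg (Neg ?U)"]) auto
  then show ?thesis
    using assms by (auto intro!: HA_if_derives_empty deduction)
qed

theorem theorem4p1:
  assumes "closed_under_MR HA"
  shows "closed_under_EMR EA"
  unfolding closed_under_EMR_def
proof (intro allI impI)
  fix f
  assume f: "pr_sym 2 f" and EA: "EA (Box (All (Dia (Ex (R f)))))"
  have L: "R f \<in> lang_HA"
    using f by (auto simp: R_def lang_HA_def numeral_2_eq_2 intro: pr_sym.Zero)
  \<comment> \<open>Of the outer three negations two come from \<open>Dia\<close> and one from
    \<open>Ex\<close>; of the inner three one comes from \<open>Ex\<close> and two from the atom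
    \<open>R f\<close>.\<close>
  have "HA (All (Neg (Neg (Neg (All (Neg (Neg (Neg (R f)))))))))"
    using HA_neg_trans_if_EA[OF EA] by (simp add: R_def)
  then have "HA (All (Neg (Neg (Ex (R f)))))"
    by (rule HA_All_mono[OF HA_double_neg_Ex[OF L]])
  then have "HA (All (Ex (R f)))"
    using assms f by (auto simp: closed_under_MR_def)
  then show "EA (Box (All (Ex (R f))))"
    by (intro EA.Nec EA_if_HA)
qed

end
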